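(* Let $\delta\ge1$ be an integer and $n\ge0$. The diameter of the graph $\mathcal{W}_n$ is $Diam(\mathcal{W}_n)=2n+1$.
   Context: The diameter is the maximum over all pairs of vertices of the shortest-path distance, where distance is the number of edges of a path (weights are ignored). The strength of a vertex $i$ in a weighted graph is $s_i=\sum_j w_{ij}$, the sum of the weights of its incident edges. The weighted graphs $\mathcal{W}_n$ ($n\ge 0$) are defined recursively for a fixed integer $\delta\ge1$. $\mathcal{W}_0$ is a triangle whose three edges have weight $1$. For $n\ge1$, $\mathcal{W}_n$ is obtained from $\mathcal{W}_{n-1}$ as follows: (I) for each vertex $i$ of $\mathcal{W}_{n-1}$, of strength $s_i$ in $\mathcal{W}_{n-1}$ (always an even integer), take $s_i/2$ new disjoint copies of $\mathcal{K}_2$ (two vertices joined by an edge of weight $1$) and join both vertices of each copy to $i$ by edges of weight $1$; (II) multiply the weight of every edge that already belonged to $\mathcal{W}_{n-1}$ by $1+\delta$. *)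

theory Defs
  imports "Graph_Theory.Pair_Digraph" "Graph_Theory.Shortest_Path"
begin

text \<open>
  An undirected weighted graph is a pair consisting of a symmetric digraph \<open>G\<close> (each edge is
  a pair of opposite arcs) and an arc weight function \<open>w\<close>, whose values matter on the arcs of
  \<open>G\<close> only.
\<close>

type_synonym 'a weighted_graph = "'a pair_pre_digraph \<times> ('a \<times> 'a \<Rightarrow> nat)"

definition strength :: "'a weighted_graph \<Rightarrow> 'a \<Rightarrow> nat" where
  "strength = (\<lambda>(G, w) i. \<Sum>e \<in> out_arcs (with_proj G) i. w e)"

text \<open>
  \<open>New n i k b\<close> is an endpoint (selected by \<open>b\<close>) of the \<open>k\<close>-th copy of the complete graph on two
  vertices that is attached to \<open>i\<close> in the \<open>n\<close>-th step; the tag \<open>n\<close> keeps the vertices added in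
  different steps distinct.
\<close>

datatype vert = Root nat | New nat vert nat bool

definition W_base :: "vert weighted_graph" where
  "W_base =
    (\<lparr> pverts = Root ` {..<3},
       parcs = {(Root a, Root b) | a b. a < 3 \<and> b < 3 \<and> a \<noteq> b} \<rparr>,
     \<lambda>e. 1)"

definition W_step :: "nat \<Rightarrow> nat \<Rightarrow> vert weighted_graph \<Rightarrow> vert weighted_graph" where
  "W_step \<delta> n = (\<lambda>(G, w).
    let copies = {(i, k). i \<in> pverts G \<and> k < strength (G, w) i div 2} in
    (\<lparr> pverts = pverts G \<union> {New n i k b | i k b. (i, k) \<in> copies},
       parcs = parcs G
         \<union> {(New n i k b, New n i k (\<not> b)) | i k b. (i, k) \<in> copies}
         \<union> {(i, New n i k b) | i k b. (i, k) \<in> copies}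
         \<union> {(New n i k b, i) | i k b. (i, k) \<in> copies} \<rparr>,
     \<lambda>e. if e \<in> parcs G then (1 + \<delta>) * w e else 1))"

primrec W :: "nat \<Rightarrow> nat \<Rightarrow> vert weighted_graph" where
  "W \<delta> 0 = W_base"
| "W \<delta> (Suc n) = W_step \<delta> (Suc n) (W \<delta> n)"

text \<open>
  The cost function that is constantly \<open>1\<close> makes \<open>\<mu>\<close> the unweighted distance, which is \<open>\<infinity>\<close>
  between vertices that are not connected.
\<close>

definition diameter :: "('a, 'b) pre_digraph \<Rightarrow> ereal" where
  "diameter G = Max {wf_digraph.\<mu> G (\<lambda>_. 1) u v | u v. u \<in> verts G \<and> v \<in> verts G}"

end

theory Submission
  imports Defs
begin

text \<open>
  Upper bound: every vertex of \<open>W \<delta> (Suc n)\<close> has distance at most 1 from \<open>W \<delta> n\<close>, so a step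
  increases the diameter by at most 2. Lower bound: the function \<open>height\<close> changes by at most 1
  along each edge. All strengths are at least 2, so each vertex receives a child in every step;
  descending from \<open>Root 0\<close> and from \<open>Root 1\<close> yields vertices of heights \<open>-n\<close> and \<open>n + 1\<close>.
\<close>

text \<open>\<open>W_step\<close> matches on a pair; restating it through \<open>fst\<close> and
  \<open>snd\<close> lets the inductions over \<open>W\<close> rewrite without splitting the graph
  built so far.\<close>

lemma pverts_W_step:
  "pverts (fst (W_step \<delta> n H)) = pverts (fst H) \<union>
    {New n i k b | i k b. i \<in> pverts (fst H) \<and> k < strength H i div 2}"
  by (cases H) (auto simp: W_step_def Let_def)

lemma parcs_W_step:
  "parcs (fst (W_step \<delta> n H)) = parcs (fst H) \<union>
    {(New n i k b, New n i k (\<not> b)) | i k b. i \<in> pverts (fst H) \<and> k < strength H i div 2} \<union>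
    {(i, New n i k b) | i k b. i \<in> pverts (fst H) \<and> k < strength H i div 2} \<union>
    {(New n i k b, i) | i k b. i \<in> pverts (fst H) \<and> k < strength H i div 2}"
  by (cases H) (simp add: W_step_def Let_def)

lemma W_step_new_arcs:
  assumes "i \<in> pverts (fst H)" "k < strength H i div 2"
  shows "(New n i k b, New n i k (\<not> b)) \<in> parcs (fst (W_step \<delta> n H))"
    and "(i, New n i k b) \<in> parcs (fst (W_step \<delta> n H))"
    and "(New n i k b, i) \<in> parcs (fst (W_step \<delta> n H))"
  using assms by (simp_all add: parcs_W_step)

lemma weight_W_step:
  "snd (W_step \<delta> n H) e = (if e \<in> parcs (fst H) then (1 + \<delta>) * snd H e else 1)"
  by (cases H) (simp add: W_step_def Let_def)

lemma vert_neq_New: "v \<noteq> New n v k b"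
  by (induction v arbitrary: n k b) auto

lemma finite_pverts_W: "finite (pverts (fst (W \<delta> n)))"
proof (induction n)
  case 0
  then show ?case by (simp add: W_base_def)
next
  case (Suc n)
  let ?H = "W \<delta> n"
  \<comment> \<open>As an image of a finite dependent product, the set of new vertices is visibly
    finite.\<close>
  have "{New (Suc n) i k b | i k b. i \<in> pverts (fst ?H) \<and> k < strength ?H i div 2} =
      (\<lambda>((i, k), b). New (Suc n) i k b) `
        ((SIGMA i:pverts (fst ?H). {..<strength ?H i div 2}) \<times> UNIV)"
    by (auto simp: image_iff)
  with Suc show ?case by (simp add: pverts_W_step)
qed

lemma parcs_W_subset: "parcs (fst (W \<delta> n)) \<subseteq> pverts (fst (W \<delta> n)) \<times> pverts (fst (W \<delta> n))"
proof (induction n)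
  case 0
  then show ?case by (auto simp: W_base_def)
next
  case (Suc n)
  then show ?case unfolding W.simps pverts_W_step parcs_W_step by blast
qed

lemma finite_parcs_W: "finite (parcs (fst (W \<delta> n)))"
  using parcs_W_subset finite_pverts_W by (meson finite_SigmaI finite_subset)

text \<open>Arcs start with weight 1 and are only multiplied by \<open>1 + \<delta>\<close>; pairs
  that are not arcs have the default weight 1, so \<open>e\<close> can be arbitrary.\<close>

lemma weight_W_pos: "0 < snd (W \<delta> n) e"
  by (induction n arbitrary: e) (auto simp: W_base_def weight_W_step)

text \<open>Old vertices keep their arcs, and a new vertex is adjacent to its parent and to its
  twin, which differ by \<open>vert_neq_New\<close>.\<close>

lemma W_two_neighbours:
  assumes "v \<in> pverts (fst (W \<delta> n))"
  shows "\<exists>a b. a \<noteq> b \<and> (v, a) \<in> parcs (fst (W \<delta> n)) \<and> (v, b) \<in> parcs (fst (W \<delta> n))"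
  using assms
proof (induction n)
  case 0
  then obtain x where x: "x < 3" "v = Root x" by (auto simp: W_base_def)
  from x(1) consider "x = 0" | "x = 1" | "x = 2" by linarith
  then show ?case
  proof cases
    case 1
    with x show ?thesis by (intro exI[of _ "Root 1"] exI[of _ "Root 2"]) (simp add: W_base_def)
  next
    case 2
    with x show ?thesis by (intro exI[of _ "Root 0"] exI[of _ "Root 2"]) (simp add: W_base_def)
  next
    case 3
    with x show ?thesis by (intro exI[of _ "Root 0"] exI[of _ "Root 1"]) (simp add: W_base_def)
  qed
next
  case (Suc n)
  show ?case
  proof (cases "v \<in> pverts (fst (W \<delta> n))")
    case True
    with Suc.IH show ?thesis unfolding W.simps parcs_W_step by blast
  next
    case False
    with Suc.prems obtain i k b where
      "v = New (Suc n) i k b" "i \<in> pverts (fst (W \<delta> n))" "k < strength (W \<delta> n) i div 2"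
      by (auto simp: pverts_W_step)
    then have "(v, i) \<in> parcs (fst (W \<delta> (Suc n)))"
      "(v, New (Suc n) i k (\<not> b)) \<in> parcs (fst (W \<delta> (Suc n)))"
      by (simp_all add: W_step_new_arcs)
    then show ?thesis using vert_neq_New by blast
  qed
qed

text \<open>Two distinct outgoing arcs contribute at least 1 each. Hence
  \<open>strength (W \<delta> n) v div 2\<close> is positive and copy number 0 is always attached to
  \<open>v\<close>.\<close>

lemma two_le_strength_W:
  assumes "v \<in> pverts (fst (W \<delta> n))"
  shows "2 \<le> strength (W \<delta> n) v"
proof -
  let ?G = "fst (W \<delta> n)" and ?w = "snd (W \<delta> n)"
  obtain a b where ab: "a \<noteq> b" "(v, a) \<in> parcs ?G" "(v, b) \<in> parcs ?G"
    using W_two_neighbours[OF assms] by blast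
  have fin: "finite (out_arcs (with_proj ?G) v)"
    by (rule finite_subset[OF _ finite_parcs_W[of \<delta> n]]) auto
  have "2 = (\<Sum>e\<in>{(v, a), (v, b)}. 1 :: nat)" using ab(1) by simp
  also have "\<dots> \<le> (\<Sum>e\<in>{(v, a), (v, b)}. ?w e)"
    by (rule sum_mono) (simp add: weight_W_pos Suc_le_eq)
  also have "\<dots> \<le> (\<Sum>e\<in>out_arcs (with_proj ?G) v. ?w e)"
    by (rule sum_mono2[OF fin]) (use ab in auto)
  also have "\<dots> = strength (W \<delta> n) v"
    by (simp add: strength_def split: prod.split)
  finally show ?thesis .
qed

lemma pcas_append: "pcas u (p @ q) v \<longleftrightarrow> (\<exists>w. pcas u p w \<and> pcas w q v)"
  by (induction p arbitrary: u) auto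

lemma W_short_walk:
  assumes "u \<in> pverts (fst (W \<delta> n))" "v \<in> pverts (fst (W \<delta> n))"
  shows "\<exists>p. set p \<subseteq> parcs (fst (W \<delta> n)) \<and> pcas u p v \<and> length p \<le> 2 * n + 1"
  using assms
proof (induction n arbitrary: u v)
  case 0
  show ?case
  proof (cases "u = v")
    case True
    then show ?thesis by (intro exI[of _ "[]"]) auto
  next
    case False
    with 0 show ?thesis by (intro exI[of _ "[(u, v)]"]) (auto simp: W_base_def)
  qed
next
  case (Suc n)
  let ?A = "parcs (fst (W \<delta> (Suc n)))"
  \<comment> \<open>Walks are directed, so both a walk \<open>p\<close> down to the older graph and
    a walk \<open>q\<close> back are needed: the first serves the start \<open>u\<close>, the second
    the end \<open>v\<close>.\<close>
  have attach: "\<exists>x' \<in> pverts (fst (W \<delta> n)). \<exists>p q. set p \<subseteq> ?A \<and> set q \<subseteq> ?A \<and>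
      pcas x p x' \<and> pcas x' q x \<and> length p \<le> 1 \<and> length q \<le> 1"
    if "x \<in> pverts (fst (W \<delta> (Suc n)))" for x
  proof (cases "x \<in> pverts (fst (W \<delta> n))")
    case True
    then show ?thesis by (intro bexI[of _ x] exI[of _ "[]"]) auto
  next
    case False
    with that obtain i k b where
      "x = New (Suc n) i k b" "i \<in> pverts (fst (W \<delta> n))" "k < strength (W \<delta> n) i div 2"
      by (auto simp: pverts_W_step)
    then show ?thesis
      by (intro bexI[of _ i] exI[of _ "[(x, i)]"] exI[of _ "[(i, x)]"])
        (simp_all add: W_step_new_arcs)
  qed
  from attach[OF Suc.prems(1)] obtain u' p where p: "u' \<in> pverts (fst (W \<delta> n))"
    "set p \<subseteq> ?A" "pcas u p u'" "length p \<le> 1" by blast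
  from attach[OF Suc.prems(2)] obtain v' q where q: "v' \<in> pverts (fst (W \<delta> n))"
    "set q \<subseteq> ?A" "pcas v' q v" "length q \<le> 1" by blast
  from Suc.IH[OF p(1) q(1)] obtain r where r: "set r \<subseteq> parcs (fst (W \<delta> n))"
    "pcas u' r v'" "length r \<le> 2 * n + 1" by blast
  have "set r \<subseteq> ?A" using r(1) by (auto simp: parcs_W_step)
  with p q r show ?case
    by (intro exI[of _ "p @ r @ q"]) (auto simp: pcas_append)
qed

text \<open>Vertices that descend from \<open>Root 0\<close> have height at most 0, all others at
  least 1. A child lies one level further out on its parent's side, and twins share a
  height.\<close>

primrec height :: "vert \<Rightarrow> int" where
  "height (Root a) = (if a = 0 then 0 else 1)"
| "height (New n i k b) = (if height i \<le> 0 then height i - 1 else height i + 1)"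

text \<open>Heights in the triangle are 0 or 1, twins have equal height, and parent and child differ
  by exactly 1.\<close>

lemma height_arc:
  assumes "(u, v) \<in> parcs (fst (W \<delta> n))"
  shows "\<bar>height u - height v\<bar> \<le> 1"
  using assms
proof (induction n)
  case 0
  then show ?case by (auto simp: W_base_def)
next
  case (Suc n)
  from Suc.prems show ?case
    unfolding W.simps parcs_W_step by (elim UnE) (use Suc.IH in auto)
qed

text \<open>Adding up \<open>height_arc\<close> along the walk with the triangle inequality turns a
  height gap into a lower bound on length.\<close>

lemma height_walk:
  assumes "set p \<subseteq> parcs (fst (W \<delta> n))" "pcas u p v"
  shows "\<bar>height u - height v\<bar> \<le> int (length p)"
  using assms
proof (induction p arbitrary: u)
  case (Cons e p)
  have "(u, snd e) \<in> parcs (fst (W \<delta> n))" using Cons.prems by (cases e) simp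
  then have "\<bar>height u - height (snd e)\<bar> \<le> 1" by (rule height_arc)
  moreover have "\<bar>height (snd e) - height v\<bar> \<le> int (length p)" using Cons by simp
  ultimately show ?case by simp
qed simp

lemma W_extreme_heights:
  "\<exists>u v. u \<in> pverts (fst (W \<delta> n)) \<and> v \<in> pverts (fst (W \<delta> n)) \<and>
    height u = - int n \<and> height v = int n + 1"
proof (induction n)
  case 0
  show ?case by (intro exI[of _ "Root 0"] exI[of _ "Root 1"]) (auto simp: W_base_def)
next
  case (Suc n)
  then obtain u v where uv: "u \<in> pverts (fst (W \<delta> n))" "v \<in> pverts (fst (W \<delta> n))"
    "height u = - int n" "height v = int n + 1" by blast
  \<comment> \<open>Strength at least 2 makes the index 0 admissible; the endpoint
    \<open>True\<close> is an arbitrary choice.\<close>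
  have "New (Suc n) i 0 True \<in> pverts (fst (W \<delta> (Suc n)))" if "i \<in> pverts (fst (W \<delta> n))" for i
    using that two_le_strength_W[OF that] by (auto simp: pverts_W_step)
  with uv show ?case
    by (intro exI[of _ "New (Suc n) u 0 True"] exI[of _ "New (Suc n) v 0 True"]) auto
qed

lemma wf_digraph_W: "wf_digraph (with_proj (fst (W \<delta> n)))"
  using parcs_W_subset[of \<delta> n] by unfold_locales auto

theorem proposition3p9:
  fixes \<delta> n :: nat
  assumes "\<delta> \<ge> 1"
  shows "diameter (with_proj (fst (W \<delta> n))) = ereal (2 * real n + 1)"
proof -
  let ?G = "fst (W \<delta> n)"
  interpret wf_digraph "with_proj ?G" by (rule wf_digraph_W)
  have cost: "awalk_cost (\<lambda>_. 1) p = real (length p)" for p :: "(vert \<times> vert) list"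
    by (induction p) auto
  have upper: "\<mu> (\<lambda>_. 1) u v \<le> ereal (2 * real n + 1)"
    if uv: "u \<in> pverts ?G" "v \<in> pverts ?G" for u v
  proof -
    obtain p where p: "set p \<subseteq> parcs ?G" "pcas u p v" "length p \<le> 2 * n + 1"
      using W_short_walk[OF uv] by blast
    then have "\<mu> (\<lambda>_. 1) u v \<le> ereal (real (length p))"
      using min_cost_le_walk_cost[of u p v "\<lambda>_. 1"] uv(1) by (simp add: cost awalk_def cas_with_proj_eq)
    also have "\<dots> \<le> ereal (2 * real n + 1)" using p(3) by simp
    finally show ?thesis .
  qed
  obtain u v where uv: "u \<in> pverts ?G" "v \<in> pverts ?G"
    "height u = - int n" "height v = int n + 1"
    using W_extreme_heights by blast
  \<comment> \<open>\<open>\<mu>\<close> is an infimum over all walks, so it suffices to bound each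
    one; the height gap is \<open>(n + 1) - (- n)\<close>.\<close>
  have "ereal (2 * real n + 1) \<le> \<mu> (\<lambda>_. 1) u v"
    unfolding \<mu>_def
  proof (rule INF_greatest)
    fix p assume "p \<in> {p. awalk u p v}"
    then have "int (2 * n + 1) \<le> int (length p)"
      using height_walk[of p \<delta> n u v] uv by (simp add: awalk_def cas_with_proj_eq)
    then show "ereal (2 * real n + 1) \<le> ereal (awalk_cost (\<lambda>_. 1) p)"
      by (simp add: cost)
  qed
  with upper[OF uv(1,2)] have eq: "\<mu> (\<lambda>_. 1) u v = ereal (2 * real n + 1)" by simp
  let ?S = "{\<mu> (\<lambda>_. 1) u v | u v. u \<in> pverts ?G \<and> v \<in> pverts ?G}"
  \<comment> \<open>The image form yields the finiteness that \<open>Max_eqI\<close>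
    requires.\<close>
  have "?S = (\<lambda>(u, v). \<mu> (\<lambda>_. 1) u v) ` (pverts ?G \<times> pverts ?G)" by auto
  then have "finite ?S" using finite_pverts_W[of \<delta> n] by simp
  then have "Max ?S = ereal (2 * real n + 1)"
  proof (rule Max_eqI)
    show "ereal (2 * real n + 1) \<in> ?S" using uv(1,2) eq by (metis (mono_tags, lifting) mem_Collect_eq)
  qed (use upper in blast)
  then show ?thesis by (simp add: diameter_def)
qed

end
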